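(* Let $\Psi=\begin{bmatrix}\Psi_{11}&\Psi_{12}\\ \Psi_{12}^\top&\Psi_{22}\end{bmatrix}\in\mathbb{R}^{(p+q)\times(p+q)}$ be symmetric with $\Psi_{11}\in\mathbb{R}^{p\times p}$, such that $\Psi_{11}-\Psi_{12}\Psi_{22}^{-1}\Psi_{12}^\top>0$ and $\Psi_{22}<0$. Let $W\in\mathbb{R}^{p\times r}$ be a full rank matrix with $r\le p$. Suppose $Z_W\in\mathbb{R}^{r\times q}$ satisfies $$\begin{bmatrix}I\\Z_W^\top\end{bmatrix}^\top\begin{bmatrix}W^\top\Psi_{11}W&W^\top\Psi_{12}\\ \Psi_{12}^\top W&\Psi_{22}\end{bmatrix}\begin{bmatrix}I\\Z_W^\top\end{bmatrix}\ge0.$$ Then there exists $Z\in\mathbb{R}^{p\times q}$ such that $Z^\top W=Z_W^\top$ and $$\begin{bmatrix}I\\Z^\top\end{bmatrix}^\top\Psi\begin{bmatrix}I\\Z^\top\end{bmatrix}\ge0.$$ *)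

theory Defs
  imports "HOL-Analysis.Analysis"
begin

text \<open>Block matrices over index types 'a + 'b (block row index) and 'c + 'd (block column index).\<close>

definition blk11 :: "real^('c::finite+'d::finite)^('a::finite+'b::finite) \<Rightarrow> real^'c^'a" where
  "blk11 M = (\<chi> i j. M $ Inl i $ Inl j)"
definition blk12 :: "real^('c::finite+'d::finite)^('a::finite+'b::finite) \<Rightarrow> real^'d^'a" where
  "blk12 M = (\<chi> i j. M $ Inl i $ Inr j)"
definition blk21 :: "real^('c::finite+'d::finite)^('a::finite+'b::finite) \<Rightarrow> real^'c^'b" where
  "blk21 M = (\<chi> i j. M $ Inr i $ Inl j)"
definition blk22 :: "real^('c::finite+'d::finite)^('a::finite+'b::finite) \<Rightarrow> real^'d^'b" where
  "blk22 M = (\<chi> i j. M $ Inr i $ Inr j)"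

definition block :: "real^'c::finite^'a::finite \<Rightarrow> real^'d::finite^'a \<Rightarrow> real^'c^'b::finite \<Rightarrow> real^'d^'b \<Rightarrow> real^('c+'d)^('a+'b)" where
  "block A B C D = (\<chi> i j. case i of
      Inl i' \<Rightarrow> (case j of Inl j' \<Rightarrow> A $ i' $ j' | Inr j' \<Rightarrow> B $ i' $ j')
    | Inr i' \<Rightarrow> (case j of Inl j' \<Rightarrow> C $ i' $ j' | Inr j' \<Rightarrow> D $ i' $ j'))"

text \<open>Vertical stacking [A; B].\<close>
definition stack :: "real^'c::finite^'a::finite \<Rightarrow> real^'c^'b::finite \<Rightarrow> real^'c^('a+'b)" where
  "stack A B = (\<chi> i. case i of Inl i' \<Rightarrow> A $ i' | Inr i' \<Rightarrow> B $ i')"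

text \<open>Loewner order relative to zero (for the symmetric matrices occurring in the statement).\<close>
definition psd :: "real^'n::finite^'n \<Rightarrow> bool" where
  "psd A \<longleftrightarrow> (\<forall>x. 0 \<le> x \<bullet> (A *v x))"
definition pos_def :: "real^'n::finite^'n \<Rightarrow> bool" where
  "pos_def A \<longleftrightarrow> (\<forall>x. x \<noteq> 0 \<longrightarrow> 0 < x \<bullet> (A *v x))"
definition neg_def :: "real^'n::finite^'n \<Rightarrow> bool" where
  "neg_def A \<longleftrightarrow> (\<forall>x. x \<noteq> 0 \<longrightarrow> x \<bullet> (A *v x) < 0)"

end

theory Submission
  imports Defs
begin

text \<open>Write Psi = [A B; B^T D] and S = A - B D^-1 B^T. Completing the square,
  [a; b]^T Psi [a; b] = a^T S a + c^T D c with c = b + D^-1 B^T a.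
  For x let W u be its S-orthogonal projection onto the range of W, and choose Z^T so that
  the vector c at (x, Z^T x) equals the one at (W u, Z_W^T u); since u depends linearly on x
  this defines a matrix, and Z^T W = Z_W^T because u = v when x = W v. Projection does not
  increase a^T S a, so the form at (x, Z^T x) dominates the form at (W u, Z_W^T u), which is
  nonnegative by hypothesis.\<close>

definition vjoin :: "real^'a::finite \<Rightarrow> real^'b::finite \<Rightarrow> real^('a+'b)" where
  "vjoin x y = (\<chi> i. case i of Inl a \<Rightarrow> x$a | Inr b \<Rightarrow> y$b)"

definition block_form ::
    "real^'n::finite^'n \<Rightarrow> real^'m::finite^'n \<Rightarrow> real^'m^'m \<Rightarrow> real^'n \<Rightarrow> real^'m \<Rightarrow> real" where
  "block_form A B D a b = a \<bullet> (A *v a) + 2 * (a \<bullet> (B *v b)) + b \<bullet> (D *v b)"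

lemma sum_UNIV_Plus:
  "sum f (UNIV :: ('a::finite + 'b::finite) set) = (\<Sum>a\<in>UNIV. f (Inl a)) + (\<Sum>b\<in>UNIV. f (Inr b))"
  using sum.Plus[of UNIV UNIV f] by simp

lemma inner_vjoin: "vjoin a b \<bullet> vjoin c d = a \<bullet> c + b \<bullet> d"
  by (simp add: inner_vec_def vjoin_def sum_UNIV_Plus)

lemma matrix_vector_mult_vjoin:
  "M *v vjoin x y = vjoin (blk11 M *v x + blk12 M *v y) (blk21 M *v x + blk22 M *v y)"
  by (auto simp: vec_eq_iff matrix_vector_mult_def vjoin_def sum_UNIV_Plus
      blk11_def blk12_def blk21_def blk22_def split: sum.splits)

lemma matrix_vector_mult_stack: "stack P Q *v x = vjoin (P *v x) (Q *v x)"
  by (auto simp: vec_eq_iff matrix_vector_mult_def vjoin_def stack_def split: sum.splits)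

lemma blk_block [simp]:
  "blk11 (block A B C D) = A" "blk12 (block A B C D) = B"
  "blk21 (block A B C D) = C" "blk22 (block A B C D) = D"
  by (auto simp: vec_eq_iff block_def blk11_def blk12_def blk21_def blk22_def)

lemma blk_transpose:
  "blk11 (transpose M) = transpose (blk11 M)"
  "blk21 (transpose M) = transpose (blk12 M)"
  "blk22 (transpose M) = transpose (blk22 M)"
  by (auto simp: vec_eq_iff transpose_def blk11_def blk12_def blk21_def blk22_def)

lemma transpose_diff: "transpose (A - B) = transpose A - transpose (B :: 'a::ab_group_add^'n^'m)"
  by (simp add: transpose_def vec_eq_iff)

lemma inner_transpose_mult: "(x::real^'m::finite) \<bullet> (transpose X *v y) = (X *v x) \<bullet> y"
  by (metis dot_lmul_matrix vector_transpose_matrix)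

lemma quadratic_form_congruence:
  "(x::real^'n::finite) \<bullet> ((transpose X ** M ** X) *v x) = (X *v x) \<bullet> (M *v (X *v x))"
  by (simp only: matrix_vector_mul_assoc[symmetric] inner_transpose_mult)

lemma quadratic_form_vjoin:
  assumes "blk21 M = transpose (blk12 M)"
  shows "vjoin a b \<bullet> (M *v vjoin a b) = block_form (blk11 M) (blk12 M) (blk22 M) a b"
proof -
  have "b \<bullet> (blk21 M *v a) = a \<bullet> (blk12 M *v b)"
    by (simp only: assms inner_transpose_mult inner_commute)
  then show ?thesis
    by (simp add: block_form_def matrix_vector_mult_vjoin inner_vjoin inner_add_right
        del: transpose_matrix_vector)
qed

lemma quadratic_form_graph:
  assumes "blk21 M = transpose (blk12 M)"
  shows "x \<bullet> ((transpose (stack (mat 1) Y) ** M ** stack (mat 1) Y) *v x)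
           = block_form (blk11 M) (blk12 M) (blk22 M) x (Y *v x)"
  by (simp only: quadratic_form_congruence matrix_vector_mult_stack matrix_vector_mul_lid
      quadratic_form_vjoin[OF assms])

lemma block_form_congruence:
  "block_form (transpose W ** A ** W) (transpose W ** B) D u b = block_form A B D (W *v u) b"
  by (simp only: block_form_def quadratic_form_congruence inner_transpose_mult
      matrix_vector_mul_assoc[symmetric])

lemma matrix_inv_right: "invertible A \<Longrightarrow> A ** matrix_inv A = mat 1"
  and matrix_inv_left: "invertible A \<Longrightarrow> matrix_inv A ** A = mat 1"
  unfolding invertible_def matrix_inv_def by (metis (mono_tags, lifting) someI_ex)+

lemma symmetric_matrix_inv:
  fixes D :: "real^'n::finite^'n"
  assumes "transpose D = D" "invertible D"
  shows "transpose (matrix_inv D) = matrix_inv D"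
proof -
  have "D ** transpose (matrix_inv D) = mat 1"
    by (metis assms matrix_inv_left matrix_transpose_mul transpose_mat)
  then have "matrix_inv D ** D ** transpose (matrix_inv D) = matrix_inv D"
    by (metis matrix_mul_assoc matrix_mul_rid)
  then show ?thesis
    by (simp add: matrix_inv_left[OF assms(2)])
qed

lemma invertible_if_definite:
  fixes M :: "real^'n::finite^'n"
  assumes "\<And>x. x \<noteq> 0 \<Longrightarrow> x \<bullet> (M *v x) \<noteq> 0"
  shows "invertible M"
  using assms matrix_left_invertible_ker invertible_left_inverse by force

lemma block_form_schur:
  fixes A :: "real^'n::finite^'n" and B :: "real^'m::finite^'n" and D :: "real^'m^'m"
    and a :: "real^'n" and b :: "real^'m"
  assumes "transpose D = D" "invertible D"
  defines "c \<equiv> b + matrix_inv D *v (transpose B *v a)"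
  shows "block_form A B D a b = a \<bullet> ((A - B ** matrix_inv D ** transpose B) *v a) + c \<bullet> (D *v c)"
proof -
  define e where "e = matrix_inv D *v (transpose B *v a)"
  have De: "D *v e = transpose B *v a"
    by (simp only: e_def matrix_vector_mul_assoc matrix_mul_assoc matrix_inv_right[OF assms(2)]
        matrix_mul_lid)
  have "b \<bullet> (D *v e) = a \<bullet> (B *v b)" "e \<bullet> (D *v b) = a \<bullet> (B *v b)"
    "e \<bullet> (D *v e) = a \<bullet> (B *v e)"
    using De assms(1) by (metis inner_commute inner_transpose_mult)+
  moreover have "a \<bullet> ((A - B ** matrix_inv D ** transpose B) *v a) = a \<bullet> (A *v a) - a \<bullet> (B *v e)"
    by (simp only: e_def matrix_vector_mult_diff_rdistrib inner_diff_right
        matrix_vector_mul_assoc matrix_mul_assoc)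
  ultimately show ?thesis
    by (simp add: block_form_def c_def e_def[symmetric] matrix_vector_right_distrib
        inner_add_left inner_add_right del: transpose_matrix_vector)
qed

lemma quadratic_form_projection_le:
  fixes S :: "real^'n::finite^'n" and W :: "real^'r::finite^'n"
  assumes "transpose S = S" "psd S"
    and normal: "transpose W *v (S *v (W *v u)) = transpose W *v (S *v x)"
  shows "(W *v u) \<bullet> (S *v (W *v u)) \<le> x \<bullet> (S *v x)"
proof -
  define e where "e = x - W *v u"
  have "(W *v u) \<bullet> (S *v e) = 0"
    by (metis e_def normal inner_transpose_mult inner_zero_right
        matrix_vector_mult_diff_distrib diff_self)
  moreover have "e \<bullet> (S *v (W *v u)) = (W *v u) \<bullet> (S *v e)"
    by (metis assms(1) inner_commute inner_transpose_mult)
  moreover have "0 \<le> e \<bullet> (S *v e)"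
    using assms(2) psd_def by blast
  moreover have "x = e + W *v u"
    by (simp add: e_def)
  ultimately show ?thesis
    by (simp add: matrix_vector_right_distrib inner_add_left inner_add_right
        del: transpose_matrix_vector)
qed

lemma block_form_extension:
  fixes A :: "real^'n::finite^'n" and B :: "real^'m::finite^'n" and D :: "real^'m^'m"
    and W :: "real^'r::finite^'n" and Y :: "real^'r^'m"
  defines "S \<equiv> A - B ** matrix_inv D ** transpose B"
  assumes "transpose A = A" "transpose D = D" "invertible D"
    and "pos_def S" "inj ((*v) W)"
    and on_range: "\<And>u. 0 \<le> block_form A B D (W *v u) (Y *v u)"
  shows "\<exists>Z. Z ** W = Y \<and> (\<forall>x. 0 \<le> block_form A B D x (Z *v x))"
proof -
  define G where "G = transpose W ** S ** W"
  have "transpose S = S"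
    using assms(2-4)
    by (simp add: S_def transpose_diff matrix_transpose_mul symmetric_matrix_inv matrix_mul_assoc)
  have "psd S"
    using \<open>pos_def S\<close> unfolding psd_def pos_def_def by (metis inner_zero_left order.refl less_imp_le)
  have "invertible G"
  proof (rule invertible_if_definite)
    fix u :: "real^'r" assume "u \<noteq> 0"
    then have "W *v u \<noteq> 0"
      using \<open>inj ((*v) W)\<close> by (metis inj_eq matrix_vector_mult_0_right)
    then show "u \<bullet> (G *v u) \<noteq> 0"
      using \<open>pos_def S\<close> unfolding pos_def_def G_def quadratic_form_congruence by force
  qed
  define P where "P = matrix_inv G ** transpose W ** S"
  define K where "K = matrix_inv D ** transpose B"
  \<comment> \<open>P x is the coefficient vector of the S-orthogonal projection of x onto the range of W\<close>
  define Z where "Z = (Y + K ** W) ** P - K"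
  have "P *v (W *v u) = u" for u
    using matrix_inv_left[OF \<open>invertible G\<close>]
    by (simp add: P_def G_def matrix_vector_mul_assoc matrix_mul_assoc del: transpose_matrix_vector)
  then have "Z ** W = Y"
    by (simp add: matrix_eq Z_def matrix_vector_mult_diff_rdistrib matrix_vector_mult_add_rdistrib
        flip: matrix_vector_mul_assoc)
  moreover have "0 \<le> block_form A B D x (Z *v x)" for x
  proof -
    define u where "u = P *v x"
    have "transpose W *v (S *v (W *v u)) = transpose W *v (S *v x)"
      using matrix_inv_right[OF \<open>invertible G\<close>]
      by (simp add: u_def P_def G_def matrix_vector_mul_assoc matrix_mul_assoc del: transpose_matrix_vector)
    then have "(W *v u) \<bullet> (S *v (W *v u)) \<le> x \<bullet> (S *v x)"
      by (rule quadratic_form_projection_le[OF \<open>transpose S = S\<close> \<open>psd S\<close>])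
    moreover have "Z *v x + matrix_inv D *v (transpose B *v x)
        = Y *v u + matrix_inv D *v (transpose B *v (W *v u))"
      by (simp add: Z_def u_def K_def matrix_vector_mult_diff_rdistrib matrix_vector_mult_add_rdistrib
          del: transpose_matrix_vector flip: matrix_vector_mul_assoc)
    ultimately have "block_form A B D (W *v u) (Y *v u) \<le> block_form A B D x (Z *v x)"
      unfolding S_def by (simp only: block_form_schur[OF assms(3,4)] add_right_mono)
    then show ?thesis
      using on_range order_trans by blast
  qed
  ultimately show ?thesis
    by blast
qed

theorem lemmaA4:
  fixes Psi :: "real^('p::finite + 'q::finite)^('p + 'q)"
    and W :: "real^'r::finite^'p"
    and ZW :: "real^'q^'r"
  assumes sym: "transpose Psi = Psi"
    and schur: "pos_def (blk11 Psi - blk12 Psi ** matrix_inv (blk22 Psi) ** transpose (blk12 Psi))"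
    and neg: "neg_def (blk22 Psi)"
    and rk: "rank W = CARD('r)"
    and rp: "CARD('r) \<le> CARD('p)"
    and ZW_ok: "psd (transpose (stack (mat 1) (transpose ZW))
                   ** block (transpose W ** blk11 Psi ** W) (transpose W ** blk12 Psi)
                            (transpose (blk12 Psi) ** W) (blk22 Psi)
                   ** stack (mat 1) (transpose ZW))"
  shows "\<exists>Z :: real^'q^'p. transpose Z ** W = transpose ZW \<and>
           psd (transpose (stack (mat 1) (transpose Z)) ** Psi ** stack (mat 1) (transpose Z))"
proof -
  have Psi_blocks: "blk21 Psi = transpose (blk12 Psi)" "transpose (blk11 Psi) = blk11 Psi"
    "transpose (blk22 Psi) = blk22 Psi"
    using blk_transpose[of Psi] sym by auto
  have "invertible (blk22 Psi)"
    by (rule invertible_if_definite) (use neg in \<open>auto simp: neg_def_def\<close>)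
  moreover have "inj ((*v) W)"
    using rk full_rank_injective by blast
  moreover have "0 \<le> block_form (blk11 Psi) (blk12 Psi) (blk22 Psi) (W *v u) (transpose ZW *v u)" for u
    using ZW_ok[unfolded psd_def, rule_format, of u]
    by (simp add: quadratic_form_graph matrix_transpose_mul block_form_congruence
        del: transpose_matrix_vector)
  ultimately obtain Z' where "Z' ** W = transpose ZW"
    and "\<forall>x. 0 \<le> block_form (blk11 Psi) (blk12 Psi) (blk22 Psi) x (Z' *v x)"
    using block_form_extension Psi_blocks schur by metis
  then show ?thesis
    by (intro exI[of _ "transpose Z'"])
      (simp add: psd_def quadratic_form_graph[OF Psi_blocks(1)] del: transpose_matrix_vector)
qed

end
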